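(* Let $n\in\{2,4,8\}$. For any two mass distributions $\mu_1,\mu_2$ on $\mathbb{R}^n$, there exist $n-1$ pairwise orthogonal hyperplanes in $\mathbb{R}^n$, each of which bisects both $\mu_1$ and $\mu_2$.
   Context: A mass distribution on $\mathbb{R}^n$ is a finite (nonnegative) measure that is absolutely continuous with respect to Lebesgue measure. A hyperplane bisects a mass distribution $\mu$ if each of its two closed half-spaces has measure $\frac12\mu(\mathbb{R}^n)$. Hyperplanes are pairwise orthogonal if their normal lines are pairwise orthogonal. *)

theory Defs
  imports "HOL-Analysis.Analysis"
begin

text \<open>Mass distributions are taken as measures on the Borel sigma-algebra.\<close>

definition mass_distribution :: "'a::euclidean_space measure \<Rightarrow> bool" where
  "mass_distribution \<mu> \<longleftrightarrow>
     finite_measure \<mu> \<and> sets \<mu> = sets borel \<and> absolutely_continuous lborel \<mu>"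

definition hyperplane :: "'a::euclidean_space set \<Rightarrow> bool" where
  "hyperplane H \<longleftrightarrow> (\<exists>a b. a \<noteq> 0 \<and> H = {x. a \<bullet> x = b})"

text \<open>
  The two closed half-spaces bounded by \<open>H\<close> do not depend, as an unordered pair, on the
  equation \<open>a \<bullet> x = b\<close> chosen for \<open>H\<close>.
\<close>

definition bisects :: "'a::euclidean_space set \<Rightarrow> 'a measure \<Rightarrow> bool" where
  "bisects H \<mu> \<longleftrightarrow>
     (\<exists>a b. a \<noteq> 0 \<and> H = {x. a \<bullet> x = b} \<and>
        measure \<mu> {x. a \<bullet> x \<le> b} = measure \<mu> UNIV / 2 \<and>
        measure \<mu> {x. a \<bullet> x \<ge> b} = measure \<mu> UNIV / 2)"

text \<open>The line through the origin orthogonal to \<open>H\<close>, when \<open>H\<close> is a hyperplane.\<close>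

definition normal_line :: "'a::euclidean_space set \<Rightarrow> 'a set" where
  "normal_line H = {v. \<forall>x\<in>H. \<forall>y\<in>H. orthogonal v (x - y)}"

definition orthogonal_hyperplanes :: "'a::euclidean_space set \<Rightarrow> 'a set \<Rightarrow> bool" where
  "orthogonal_hyperplanes H K \<longleftrightarrow>
     (\<forall>u\<in>normal_line H. \<forall>v\<in>normal_line K. orthogonal u v)"

end

theory Submission
  imports Defs "HOL-Homology.Simplices"
begin

text \<open>
  For \<open>v \<noteq> 0\<close> let \<open>t\<close> be a median of \<open>\<mu>\<^sub>1 + \<mu>\<^sub>2\<close> in direction \<open>v\<close>, and let \<open>f v\<close> be the amount by which the
  \<open>\<mu>\<^sub>1\<close>-mass of \<open>v \<bullet> x \<le> t\<close> exceeds one half. Since both masses are monotone in \<open>t\<close>, this does not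
  depend on the choice of the median, so \<open>f\<close> is odd and continuous although \<open>t\<close> need not be; at a
  zero of \<open>f\<close> the hyperplane \<open>v \<bullet> x = t\<close> bisects both masses. Multiplication by the units of the
  complex numbers, quaternions or octonions gives linear maps \<open>E i\<close> such that the vectors \<open>E i x\<close> are
  pairwise orthogonal, and the Borsuk-Ulam theorem gives a common zero of the \<open>n - 1\<close> odd functions
  \<open>f \<circ> E i\<close>.

  The Borsuk-Ulam theorem follows from Fan's counting argument, carried out on singular chains.
  The hemispheres \<open>h k\<close> of the octahedral spheres satisfy \<open>\<partial> (h (k + 1)) = \<plusminus> (h k \<plusminus> a (h k))\<close>, where \<open>a\<close>
  is the chain map of the antipodal map, and iterated
  barycentric subdivision commutes with the boundary and with the antipodal map. If there is no
  common zero, label each point by the index and sign of a component of largest modulus. The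
  number of alternating simplices in the boundary of a chain is congruent modulo 2 to the number of
  positive and negative alternating simplices in the chain, so by induction the latter number is
  odd for the subdivision of each \<open>h k\<close>; but for \<open>k = N\<close> there are too few labels.
\<close>

section \<open>Alternating label lists\<close>

fun alternating :: "bool \<Rightarrow> nat list \<Rightarrow> bool" where
  "alternating s [] \<longleftrightarrow> True"
| "alternating s (x # xs) \<longleftrightarrow> (even x = s \<and> alternating (\<not> s) xs)"

definition omit :: "nat \<Rightarrow> 'a list \<Rightarrow> 'a list" where
  "omit i xs = take i xs @ drop (Suc i) xs"

lemma omit_Cons_0 [simp]: "omit 0 (x # xs) = xs"
  and omit_Cons_Suc [simp]: "omit (Suc i) (x # xs) = x # omit i xs"
  by (simp_all add: omit_def)

lemma mset_omit: "i < length xs \<Longrightarrow> mset (omit i xs) = mset xs - {#xs ! i#}"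
proof (induction xs arbitrary: i)
  case (Cons x xs)
  then show ?case
    by (cases i) auto
qed simp

lemma set_omit: "set (omit i xs) \<subseteq> set xs"
  by (auto simp: omit_def dest: in_set_takeD in_set_dropD)

lemma sorted_omit: "sorted xs \<Longrightarrow> sorted (omit i xs)"
proof (induction xs arbitrary: i)
  case (Cons x xs)
  then show ?case
    using set_omit by (cases i) fastforce+
qed (simp add: omit_def)

text \<open>If a nonempty list alternates, exactly one deletion alternates from \<open>s\<close>:
  that of the last entry if the list starts with \<open>s\<close>, that of the first entry
  otherwise. Any other list has no such deletion or exactly two, namely the members of its only
  adjacent pair of equal parity.\<close>

lemma alternating_omit_parity:
  "even ((\<Sum>i<length xs. of_bool (alternating s (omit i xs))) +
     of_bool (alternating s xs) + of_bool (alternating (\<not> s) xs) :: int)"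
proof (induction xs arbitrary: s)
  case (Cons x xs)
  have "(\<Sum>i<length (x # xs). of_bool (alternating s (omit i (x # xs)))) =
     of_bool (alternating s xs) +
     (if even x = s then \<Sum>i<length xs. of_bool (alternating (\<not> s) (omit i xs)) else 0 :: int)"
    by (simp add: sum.lessThan_Suc_shift del: sum.lessThan_Suc)
  then show ?case
    using Cons.IH[of "\<not> s"] by auto
qed auto

text \<open>In the encoding of signed labels introduced below, sorting orders labels by index, and
  parity is the sign. These are Fan's alternating simplices, positive for \<open>s = True\<close>
  and negative for \<open>s = False\<close>.\<close>

definition sort_alternating :: "bool \<Rightarrow> nat list \<Rightarrow> bool" where
  "sort_alternating s xs \<longleftrightarrow> alternating s (sort xs)"

lemma sort_alternating_omit_parity:
  "even ((\<Sum>i<length xs. of_bool (sort_alternating s (omit i xs))) +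
     of_bool (sort_alternating s xs) + of_bool (sort_alternating (\<not> s) xs) :: int)"
proof -
  \<comment> \<open>A term depends only on the deleted value and on the multiset of entries, so the
    sum is the same for \<open>xs\<close> and for \<open>sort xs\<close>.\<close>
  define h :: "nat \<Rightarrow> int" where
    "h = (\<lambda>x. of_bool (alternating s (sorted_list_of_multiset (mset xs - {#x#}))))"
  have sum_h: "(\<Sum>i<length zs. h (zs ! i)) = sum_mset (image_mset h (mset zs))" for zs
    by (simp add: sum_list_sum_nth atLeast0LessThan sum_mset_sum_list flip: mset_map)
  have "(\<Sum>i<length xs. of_bool (sort_alternating s (omit i xs))) = (\<Sum>i<length xs. h (xs ! i))"
    by (intro sum.cong refl)
      (simp add: h_def sort_alternating_def flip: mset_omit sorted_list_of_multiset_mset)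
  also have "\<dots> = (\<Sum>i<length (sort xs). h (sort xs ! i))"
    unfolding sum_h by simp
  also have "\<dots> = (\<Sum>i<length (sort xs). of_bool (alternating s (omit i (sort xs))))"
  proof (intro sum.cong refl)
    fix i assume "i \<in> {..<length (sort xs)}"
    then have "mset xs - {#sort xs ! i#} = mset (omit i (sort xs))"
      by (simp add: mset_omit)
    then show "h (sort xs ! i) = of_bool (alternating s (omit i (sort xs)))"
      by (simp add: h_def sorted_omit sorted_sort_id)
  qed
  finally show ?thesis
    using alternating_omit_parity[of s "sort xs"] by (simp add: sort_alternating_def)
qed

text \<open>The natural numbers \<open>2 i\<close> and \<open>2 i + 1\<close> encode the labels \<open>+i\<close> and \<open>-i\<close> of Fan's lemma.\<close>

definition opposite :: "nat \<Rightarrow> nat" where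
  "opposite n = (if even n then Suc n else n - 1)"

definition complementary_free :: "nat set \<Rightarrow> bool" where
  "complementary_free A \<longleftrightarrow> (\<forall>x\<in>A. opposite x \<notin> A)"

text \<open>\<open>opposite\<close> only exchanges the two members of each pair \<open>2 i\<close>,
  \<open>2 i + 1\<close>, and a complementary-free set meets each pair at most once.\<close>

lemma opposite_mono_on:
  assumes "complementary_free A"
  shows "mono_on A opposite"
proof (rule mono_onI)
  fix x y assume xy: "x \<in> A" "y \<in> A" "x \<le> y"
  then have "y \<noteq> opposite x"
    using assms by (auto simp: complementary_free_def)
  with xy(3) show "opposite x \<le> opposite y"
    by (auto simp: opposite_def elim!: evenE oddE split: if_splits)
qed

lemma alternating_map_opposite: "alternating s (map opposite xs) \<longleftrightarrow> alternating (\<not> s) xs"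
proof (induction xs arbitrary: s)
  case (Cons x xs)
  have "even (opposite x) \<longleftrightarrow> odd x"
    by (auto simp: opposite_def)
  with Cons show ?case by auto
qed simp

lemma sorted_map_mono_on: "sorted xs \<Longrightarrow> mono_on (set xs) f \<Longrightarrow> sorted (map f xs)"
  by (induction xs) (auto simp: mono_on_def)

lemma sort_alternating_map_opposite:
  assumes "complementary_free (set xs)"
  shows "sort_alternating s (map opposite xs) \<longleftrightarrow> sort_alternating (\<not> s) xs"
proof -
  have "sorted (map opposite (sort xs))"
    using opposite_mono_on[OF assms] by (intro sorted_map_mono_on) simp_all
  then have "sort (map opposite xs) = map opposite (sort xs)"
    by (metis mset_map mset_sort properties_for_sort)
  then show ?thesis
    by (simp add: sort_alternating_def alternating_map_opposite)
qed

lemma sorted_alternating_distinct: "sorted xs \<Longrightarrow> alternating s xs \<Longrightarrow> distinct xs"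
proof (induction xs arbitrary: s)
  case (Cons x xs)
  have "x \<notin> set xs"
  proof
    assume "x \<in> set xs"
    then obtain y ys where xs: "xs = y # ys" by (cases xs) auto
    with \<open>x \<in> set xs\<close> Cons.prems(1) have "y = x" by auto
    with Cons.prems(2) xs show False by auto
  qed
  with Cons show ?case by auto
qed simp

text \<open>Alternation makes the labels distinct, and the absence of opposite labels then makes
  their indices distinct; there are only \<open>N\<close> indices.\<close>

lemma sort_alternating_length_le:
  assumes "complementary_free (set xs)" "sort_alternating s xs" "\<And>x. x \<in> set xs \<Longrightarrow> x < 2 * N"
  shows "length xs \<le> N"
proof -
  have "distinct xs"
    using sorted_alternating_distinct[of "sort xs" s] assms(2) by (simp add: sort_alternating_def)
  moreover have "inj_on (\<lambda>x. x div 2) (set xs)"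
  proof (rule inj_onI)
    fix x y assume xy: "x \<in> set xs" "y \<in> set xs" "x div 2 = y div 2"
    then have "y \<noteq> opposite x"
      using assms(1) by (auto simp: complementary_free_def)
    with xy(3) show "x = y"
      by (auto simp: opposite_def elim!: evenE oddE split: if_splits)
  qed
  then have "card (set xs) \<le> card {..<N}"
    using assms(3) by (intro card_inj_on_le[of "\<lambda>x. x div 2"]) (auto simp: less_mult_imp_div_less mult.commute)
  ultimately show ?thesis
    by (simp add: distinct_card)
qed

section \<open>Parity counts of alternating simplices\<close>

text \<open>The sum of the coefficients of the generators satisfying \<open>P\<close>. The free
  abelian group on one point stands for the integers, so that linearity comes from
  \<open>frag_extend\<close>.\<close>

definition chain_count :: "('b \<Rightarrow> bool) \<Rightarrow> ('b \<Rightarrow>\<^sub>0 int) \<Rightarrow> int" where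
  "chain_count P c =
     Poly_Mapping.lookup (frag_extend (\<lambda>x. frag_cmul (of_bool (P x)) (frag_of ())) c) ()"

lemma chain_count_0 [simp]: "chain_count P 0 = 0"
  by (simp add: chain_count_def)

lemma chain_count_of [simp]: "chain_count P (frag_of x) = of_bool (P x)"
  by (simp add: chain_count_def)

lemma chain_count_add: "chain_count P (a + b) = chain_count P a + chain_count P b"
  by (simp add: chain_count_def frag_extend_add lookup_add)

lemma chain_count_diff: "chain_count P (a - b) = chain_count P a - chain_count P b"
  by (simp add: chain_count_def frag_extend_diff lookup_minus)

lemma chain_count_cmul: "chain_count P (frag_cmul k a) = k * chain_count P a"
  by (simp add: chain_count_def frag_extend_cmul)

lemma chain_count_sum:
  "finite I \<Longrightarrow> chain_count P (\<Sum>i\<in>I. g i) = (\<Sum>i\<in>I. chain_count P (g i))"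
  by (induction I rule: finite_induct) (simp_all add: chain_count_add)

lemma chain_count_chain_map: "chain_count P (chain_map p g c) = chain_count (P \<circ> simplex_map p g) c"
  unfolding chain_count_def chain_map_def
  unfolding frag_extend_compose by (simp add: comp_def)

lemma chain_count_cong:
  "(\<And>x. x \<in> Poly_Mapping.keys c \<Longrightarrow> P x = Q x) \<Longrightarrow> chain_count P c = chain_count Q c"
  unfolding chain_count_def
  by (rule arg_cong[where f = "\<lambda>c. Poly_Mapping.lookup c ()"], rule frag_extend_eq) simp

lemma chain_count_eq_0:
  "(\<And>x. x \<in> Poly_Mapping.keys c \<Longrightarrow> \<not> P x) \<Longrightarrow> chain_count P c = 0"
  unfolding chain_count_def by (subst frag_extend_eq_0) auto

abbreviation simplex_vertex :: "nat \<Rightarrow> nat \<Rightarrow> real" where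
  "simplex_vertex i \<equiv> (\<lambda>j. if j = i then 1 else 0)"

definition vertex_labels :: "('a \<Rightarrow> nat) \<Rightarrow> nat \<Rightarrow> ((nat \<Rightarrow> real) \<Rightarrow> 'a) \<Rightarrow> nat list" where
  "vertex_labels L p f = map (\<lambda>i. L (f (simplex_vertex i))) [0..<Suc p]"

lemma length_vertex_labels [simp]: "length (vertex_labels L p f) = Suc p"
  by (simp add: vertex_labels_def)

lemma nth_omit: "i < length xs - 1 \<Longrightarrow>
    omit j xs ! i = xs ! (if i < j then i else Suc i)"
  by (auto simp: omit_def nth_append min_def)

lemma simplical_face_vertex:
  "simplical_face k (simplex_vertex i) = (simplex_vertex (if i < k then i else Suc i) :: nat \<Rightarrow> real)"
  by (auto simp: simplical_face_def fun_eq_iff)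

lemma vertex_labels_singular_face:
  assumes "1 \<le> p" "k \<le> p"
  shows "vertex_labels L (p - Suc 0) (singular_face p k f) = omit k (vertex_labels L p f)"
proof (rule nth_equalityI)
  show "length (vertex_labels L (p - Suc 0) (singular_face p k f)) =
      length (omit k (vertex_labels L p f))"
    using assms by (simp add: omit_def)
  fix i assume "i < length (vertex_labels L (p - Suc 0) (singular_face p k f))"
  then have i: "i < p" "i \<le> p - Suc 0" using assms by auto
  then have "vertex_labels L (p - Suc 0) (singular_face p k f) ! i =
      L (f (simplex_vertex (if i < k then i else Suc i)))"
    using assms i
    by (simp add: vertex_labels_def singular_face_def simplical_face_vertex del: upt_Suc)
  also have "\<dots> = omit k (vertex_labels L p f) ! i"
    using assms i by (simp add: nth_omit) (simp add: vertex_labels_def del: upt_Suc)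
  finally show "vertex_labels L (p - Suc 0) (singular_face p k f) ! i = \<dots>" .
qed

definition alternating_count :: "bool \<Rightarrow> ('a \<Rightarrow> nat) \<Rightarrow> nat \<Rightarrow> 'a chain \<Rightarrow> int" where
  "alternating_count s L p = chain_count (\<lambda>f. sort_alternating s (vertex_labels L p f))"

text \<open>By linearity a single simplex suffices. Its faces carry the label lists with one entry
  deleted, and the signs of the boundary vanish modulo 2, which leaves the parity statement for
  lists.\<close>

lemma alternating_count_boundary:
  assumes "1 \<le> p"
  shows "even (alternating_count s L (p - Suc 0) (chain_boundary p c) +
     alternating_count s L p c + alternating_count (\<not> s) L p c)"
proof (induction c rule: frag_induction[OF subset_UNIV])
  case 1
  then show ?case by (simp add: alternating_count_def chain_boundary_def)
next
  case (2 f)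
  let ?A = "\<lambda>s k. of_bool (sort_alternating s (omit k (vertex_labels L p f))) :: int"
  have "alternating_count s L (p - Suc 0) (chain_boundary p (frag_of f)) =
      (\<Sum>k\<le>p. (- 1) ^ k * ?A s k)"
    using assms
    by (simp add: alternating_count_def chain_boundary_of chain_count_sum chain_count_cmul
        vertex_labels_singular_face)
  moreover have "even ((\<Sum>k\<le>p. (- 1) ^ k * ?A s k) - (\<Sum>k\<le>p. ?A s k))"
    by (subst sum_subtractf[symmetric], rule dvd_sum)
      simp
  ultimately show ?case
    using sort_alternating_omit_parity[of s "vertex_labels L p f"]
    by (simp add: alternating_count_def lessThan_Suc_atMost)
next
  case (3 a b)
  from dvd_diff[OF this] show ?case
    unfolding alternating_count_def chain_boundary_diff chain_count_diff
    by (simp add: algebra_simps del: even_add even_diff)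
qed

section \<open>The octahedral chains\<close>

lemma singular_subdivision_power_add:
  "(singular_subdivision p ^^ m) (a + b) = (singular_subdivision p ^^ m) a + (singular_subdivision p ^^ m) b"
  by (induction m) (simp_all add: singular_subdivision_add)

lemma singular_subdivision_power_cmul:
  "(singular_subdivision p ^^ m) (frag_cmul k c) = frag_cmul k ((singular_subdivision p ^^ m) c)"
  by (induction m) (simp_all add: singular_subdivision_def frag_extend_cmul)

lemma singular_chain_singular_subdivision_power:
  "singular_chain p X c \<Longrightarrow> singular_chain p X ((singular_subdivision p ^^ m) c)"
  by (induction m) (simp_all add: singular_chain_singular_subdivision)

lemma chain_map_singular_subdivision_power:
  assumes "singular_chain p X c"
  shows "(singular_subdivision p ^^ m) (chain_map p g c) = chain_map p g ((singular_subdivision p ^^ m) c)"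
  by (induction m)
    (simp_all add: naturality_singular_subdivision[OF singular_chain_singular_subdivision_power[OF assms]])

lemma chain_boundary_singular_subdivision_power:
  assumes "singular_chain p X c"
  shows "chain_boundary p ((singular_subdivision p ^^ m) c) =
    (singular_subdivision (p - Suc 0) ^^ m) (chain_boundary p c)"
  by (induction m)
    (simp_all add: chain_boundary_singular_subdivision[OF singular_chain_singular_subdivision_power[OF assms]])

lemma singular_subdivision_power_zero:
  "singular_chain 0 X c \<Longrightarrow> (singular_subdivision 0 ^^ m) c = c"
  by (induction m) (simp_all add: singular_subdivision_zero)

text \<open>The restriction makes the map extensional on the standard simplex, as
  \<open>singular_simplex\<close> demands.\<close>

definition affine_simplex :: "nat \<Rightarrow> (nat \<Rightarrow> 'a::real_vector) \<Rightarrow> (nat \<Rightarrow> real) \<Rightarrow> 'a" where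
  "affine_simplex p w = restrict (\<lambda>t. \<Sum>i\<le>p. t i *\<^sub>R w i) (standard_simplex p)"

lemma singular_face_affine_simplex:
  assumes "1 \<le> p" "k \<le> p"
  shows "singular_face p k (affine_simplex p w) =
    affine_simplex (p - Suc 0) (\<lambda>i. w (if i < k then i else Suc i))"
proof -
  have "(\<Sum>i\<le>p. simplical_face k t i *\<^sub>R w i) =
      (\<Sum>i\<le>p - Suc 0. t i *\<^sub>R w (if i < k then i else Suc i))" for t :: "nat \<Rightarrow> real"
  proof -
    have "(\<Sum>i\<le>p. simplical_face k t i *\<^sub>R w i) = (\<Sum>i\<in>{..p} - {k}. simplical_face k t i *\<^sub>R w i)"
      by (rule sum.mono_neutral_right) (auto simp: simplical_face_def)
    also have "\<dots> = (\<Sum>i\<le>p - Suc 0. t i *\<^sub>R w (if i < k then i else Suc i))"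
      using assms
      by (intro sum.reindex_bij_witness[of _ "\<lambda>i. if i < k then i else Suc i"
            "\<lambda>i. if i < k then i else i - 1"])
        (auto simp: simplical_face_def)
    finally show ?thesis .
  qed
  then show ?thesis
    using assms simplical_face_in_standard_simplex[of p k]
    by (auto simp: singular_face_def affine_simplex_def fun_eq_iff restrict_def)
qed

lemma singular_simplex_affine_simplex:
  fixes w :: "nat \<Rightarrow> 'a::real_normed_vector"
  assumes "\<And>t. t \<in> standard_simplex p \<Longrightarrow> (\<Sum>i\<le>p. t i *\<^sub>R w i) \<in> S"
  shows "singular_simplex p (top_of_set S) (affine_simplex p w)"
proof -
  have "continuous_map (subtopology (powertop_real UNIV) (standard_simplex p)) euclidean
      (\<lambda>t. t i *\<^sub>R w i)" for i
  proof -
    have "continuous_map (subtopology (powertop_real UNIV) (standard_simplex p)) euclideanreal (\<lambda>t. t i)"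
      by (intro continuous_map_from_subtopology continuous_map_product_projection) simp
    moreover have "continuous_map euclideanreal euclidean (\<lambda>r. r *\<^sub>R w i)"
      by (simp add: continuous_intros)
    ultimately show ?thesis
      by (rule continuous_map_compose[unfolded comp_def])
  qed
  then have "continuous_map (subtopology (powertop_real UNIV) (standard_simplex p)) euclidean
      (\<lambda>t. \<Sum>i\<le>p. t i *\<^sub>R w i)"
    by (intro continuous_map_sum) simp_all
  then have "continuous_map (subtopology (powertop_real UNIV) (standard_simplex p)) (top_of_set S)
      (\<lambda>t. \<Sum>i\<le>p. t i *\<^sub>R w i)"
    using assms by (auto simp: continuous_map_in_subtopology)
  then have "continuous_map (subtopology (powertop_real UNIV) (standard_simplex p)) (top_of_set S)
      (affine_simplex p w)"
    by (rule continuous_map_eq) (simp add: affine_simplex_def)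
  then show ?thesis
    by (simp add: singular_simplex_def affine_simplex_def)
qed

definition signed_vertices :: "nat set \<Rightarrow> (nat \<Rightarrow> 'a::real_vector) \<Rightarrow> nat \<Rightarrow> 'a" where
  "signed_vertices A b i = (if i \<in> A then - b i else b i)"

text \<open>The hemisphere of the \<open>k\<close>-dimensional octahedral sphere on the side of the vertex \<open>b k\<close>.\<close>

definition octahedral_chain :: "(nat \<Rightarrow> 'a::real_vector) \<Rightarrow> nat \<Rightarrow> 'a chain" where
  "octahedral_chain b k =
     (\<Sum>A\<in>Pow {..<k}. frag_cmul ((- 1) ^ card A) (frag_of (affine_simplex k (signed_vertices A b))))"

lemma sum_Pow_insert:
  fixes F :: "'b set \<Rightarrow> 'c::comm_monoid_add"
  assumes "finite S" "j \<notin> S"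
  shows "sum F (Pow (insert j S)) = sum F (Pow S) + (\<Sum>A\<in>Pow S. F (insert j A))"
proof -
  have "inj_on (insert j) (Pow S)"
    using assms(2) by (auto simp: inj_on_def)
  moreover have "Pow S \<inter> insert j ` Pow S = {}"
    using assms(2) by auto
  ultimately show ?thesis
    using assms(1) by (simp add: Pow_insert sum.union_disjoint sum.reindex)
qed

lemma affine_simplex_cong: "(\<And>i. i \<le> p \<Longrightarrow> w i = w' i) \<Longrightarrow> affine_simplex p w = affine_simplex p w'"
  by (simp add: affine_simplex_def)

lemma simplex_map_uminus_affine_simplex:
  "simplex_map p uminus (affine_simplex p w) = affine_simplex p (\<lambda>i. - w i)"
  by (auto simp: simplex_map_def affine_simplex_def fun_eq_iff sum_negf)

text \<open>Faces opposite a vertex \<open>j \<le> k\<close> cancel in pairs that differ in the sign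
  at \<open>j\<close>. The faces opposite the apex form the whole \<open>k\<close>-dimensional
  octahedral sphere; those with \<open>k\<close> outside \<open>A\<close> give one hemisphere, the
  others its antipodal image.\<close>

lemma chain_boundary_octahedral_chain:
  "chain_boundary (Suc k) (octahedral_chain b (Suc k)) =
     frag_cmul ((- 1) ^ Suc k) (octahedral_chain b k +
       frag_cmul ((- 1) ^ Suc k) (chain_map k uminus (octahedral_chain b k)))"
proof -
  define F where "F j A = frag_cmul ((- 1) ^ card A)
      (frag_of (affine_simplex k (\<lambda>i. signed_vertices A b (if i < j then i else Suc i))))" for j A
  have "chain_boundary (Suc k) (octahedral_chain b (Suc k)) =
      (\<Sum>A\<in>Pow {..<Suc k}. \<Sum>j\<le>Suc k. frag_cmul ((- 1) ^ j) (F j A))"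
    by (simp add: octahedral_chain_def chain_boundary_sum chain_boundary_cmul chain_boundary_of
        singular_face_affine_simplex frag_cmul_sum F_def comp_def mult.commute
        del: sum.atMost_Suc Pow_iff)
  also have "\<dots> = (\<Sum>j\<le>Suc k. frag_cmul ((- 1) ^ j) (sum (F j) (Pow {..<Suc k})))"
    by (subst sum.swap) (simp only: frag_cmul_sum)
  also have "\<dots> = frag_cmul ((- 1) ^ Suc k) (sum (F (Suc k)) (Pow {..<Suc k}))"
  proof -
    have "sum (F j) (Pow {..<Suc k}) = 0" if "j \<le> k" for j
    proof -
      let ?S = "{..<Suc k} - {j}"
      \<comment> \<open>The face opposite vertex \<open>j\<close> does not see the sign at
        \<open>j\<close>; only the parity of \<open>card A\<close> changes.\<close>
      have "F j (insert j A) = - F j A" if "A \<in> Pow ?S" for A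
      proof -
        have "finite A" "j \<notin> A"
          using that by (auto intro: finite_subset)
        moreover have "signed_vertices (insert j A) b (if i < j then i else Suc i) =
            signed_vertices A b (if i < j then i else Suc i)" for i
          by (auto simp: signed_vertices_def)
        ultimately show ?thesis
          by (simp add: F_def)
      qed
      then have "(\<Sum>A\<in>Pow ?S. F j (insert j A)) = - sum (F j) (Pow ?S)"
        by (simp add: sum_negf del: Pow_iff)
      then have "sum (F j) (Pow (insert j ?S)) = 0"
        by (subst sum_Pow_insert) auto
      with that show ?thesis
        by (simp add: insert_absorb)
    qed
    then show ?thesis by simp
  qed
  also have "sum (F (Suc k)) (Pow {..<Suc k}) =
      sum (F (Suc k)) (Pow {..<k}) + (\<Sum>A\<in>Pow {..<k}. F (Suc k) (insert k A))"
    by (simp add: lessThan_Suc sum_Pow_insert)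
  also have "sum (F (Suc k)) (Pow {..<k}) = octahedral_chain b k"
    unfolding octahedral_chain_def F_def
    by (intro sum.cong refl arg_cong2[where f = frag_cmul] arg_cong[where f = frag_of] affine_simplex_cong)
      auto
  also have "(\<Sum>A\<in>Pow {..<k}. F (Suc k) (insert k A)) =
      frag_cmul ((- 1) ^ Suc k) (chain_map k uminus (octahedral_chain b k))"
  proof -
    have "frag_cmul ((- 1) ^ Suc k) (chain_map k uminus (octahedral_chain b k)) =
       (\<Sum>A\<in>Pow {..<k}. frag_cmul ((- 1) ^ Suc k * (- 1) ^ card A)
         (frag_of (affine_simplex k (\<lambda>i. - signed_vertices A b i))))"
      by (simp add: octahedral_chain_def chain_map_sum frag_cmul_sum simplex_map_uminus_affine_simplex)
    also have "\<dots> = (\<Sum>A\<in>Pow {..<k}. F (Suc k) (insert k A))"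
    \<comment> \<open>Negating all signed vertices replaces the set of negative indices by its
      complement in \<open>{..k}\<close>.\<close>
    proof (rule sum.reindex_bij_witness[of _ "\<lambda>A. {..<k} - A" "\<lambda>A. {..<k} - A"])
      fix A assume A: "A \<in> Pow {..<k}"
      then have fin: "finite A" and le: "card A \<le> k"
        using card_mono[of "{..<k}" A] by (auto intro: finite_subset)
      have "card (insert k ({..<k} - A)) = Suc (k - card A)"
        using A fin by (simp add: card_Diff_subset)
      moreover have "(- 1 :: int) ^ Suc (k - card A) = (- 1) ^ Suc k * (- 1) ^ card A"
        using le by (simp add: uminus_power_if)
      moreover have "affine_simplex k (\<lambda>i. - signed_vertices A b i) =
          affine_simplex k (\<lambda>i. signed_vertices (insert k ({..<k} - A)) b (if i < Suc k then i else Suc i))"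
        using A by (intro affine_simplex_cong) (auto simp: signed_vertices_def)
      ultimately show "F (Suc k) (insert k ({..<k} - A)) = frag_cmul ((- 1) ^ Suc k * (- 1) ^ card A)
         (frag_of (affine_simplex k (\<lambda>i. - signed_vertices A b i)))"
        by (simp add: F_def)
    qed auto
    finally show ?thesis ..
  qed
  finally show ?thesis .
qed

text \<open>Pairing with \<open>b j\<close> recovers the weight \<open>t j\<close> up to sign, so a
  combination equal to 0 would have all weights 0, although they sum to 1.\<close>

lemma singular_chain_octahedral_chain:
  fixes b :: "nat \<Rightarrow> 'a::real_inner"
  assumes b: "\<And>i j. i \<le> k \<Longrightarrow> j \<le> k \<Longrightarrow> b i \<bullet> b j = of_bool (i = j)"
  shows "singular_chain k (top_of_set (- {0})) (octahedral_chain b k)"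
  unfolding octahedral_chain_def
proof (intro singular_chain_sum singular_chain_cmul)
  fix A :: "nat set"
  have "(\<Sum>i\<le>k. t i *\<^sub>R signed_vertices A b i) \<noteq> 0" if t: "t \<in> standard_simplex k" for t
  proof
    assume sum0: "(\<Sum>i\<le>k. t i *\<^sub>R signed_vertices A b i) = 0"
    have "t j = 0" if "j \<le> k" for j
    proof -
      have "0 = (\<Sum>i\<le>k. t i *\<^sub>R signed_vertices A b i) \<bullet> b j"
        by (simp add: sum0)
      also have "\<dots> = (\<Sum>i\<le>k. if i = j then (if j \<in> A then - t j else t j) else 0)"
        unfolding inner_sum_left using that by (intro sum.cong) (auto simp: signed_vertices_def b)
      finally show ?thesis
        using that by (simp split: if_splits)
    qed
    then have "(\<Sum>j\<le>k. t j) = 0" by simp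
    with t show False by (simp add: standard_simplex_def)
  qed
  then show "singular_chain k (top_of_set (- {0})) (frag_of (affine_simplex k (signed_vertices A b)))"
    by (simp add: singular_chain_of singular_simplex_affine_simplex)
qed

section \<open>The Borsuk-Ulam theorem\<close>

text \<open>The antipodal map turns each vertex label into its opposite. Without complementary
  labels this preserves the order by index and flips every sign.\<close>

lemma alternating_count_uminus:
  assumes sing: "singular_chain p (top_of_set (- {0 :: 'a::real_normed_vector})) c"
    and L: "\<And>x. x \<noteq> 0 \<Longrightarrow> L (- x) = opposite (L x)"
    and free: "\<And>f. f \<in> Poly_Mapping.keys c \<Longrightarrow> complementary_free (set (vertex_labels L p f))"
  shows "alternating_count s L p (chain_map p uminus c) = alternating_count (\<not> s) L p c"
  unfolding alternating_count_def chain_count_chain_map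
proof (rule chain_count_cong)
  fix f assume f: "f \<in> Poly_Mapping.keys c"
  then have "singular_simplex p (top_of_set (- {0})) f"
    using sing by (auto simp: singular_chain_def)
  then have "f \<in> standard_simplex p \<rightarrow> - {0}"
    by (auto simp: singular_simplex_def continuous_map_def)
  then have "vertex_labels L p (simplex_map p uminus f) = map opposite (vertex_labels L p f)"
    by (auto simp: vertex_labels_def simplex_map_def L less_Suc_eq_le Pi_iff simp del: upt_Suc)
  then show "((\<lambda>f. sort_alternating s (vertex_labels L p f)) \<circ> simplex_map p uminus) f =
      sort_alternating (\<not> s) (vertex_labels L p f)"
    using free[OF f] by (simp add: sort_alternating_map_opposite)
qed

text \<open>\<open>c 0\<close> is one vertex, of exactly one sign. Modulo 2, the positive count of
  the boundary of \<open>c (Suc k)\<close> is that of \<open>c k\<close> plus that of its antipode,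
  hence the total count of \<open>c k\<close>; by \<open>alternating_count_boundary\<close> it is
  also the total count of \<open>c (Suc k)\<close>.\<close>

lemma octahedral_alternating_count_odd:
  fixes b :: "nat \<Rightarrow> 'a::real_inner" and L :: "'a \<Rightarrow> nat"
  assumes b: "\<And>i j. i \<le> N \<Longrightarrow> j \<le> N \<Longrightarrow> b i \<bullet> b j = of_bool (i = j)"
    and L: "\<And>x. x \<noteq> 0 \<Longrightarrow> L (- x) = opposite (L x)"
    and free: "\<And>k f. k \<le> N \<Longrightarrow>
      f \<in> Poly_Mapping.keys ((singular_subdivision k ^^ m) (octahedral_chain b k)) \<Longrightarrow>
      complementary_free (set (vertex_labels L k f))"
    and "k \<le> N"
  defines "c \<equiv> \<lambda>k. (singular_subdivision k ^^ m) (octahedral_chain b k)"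
  shows "odd (alternating_count True L k (c k) + alternating_count False L k (c k))"
  using \<open>k \<le> N\<close>
proof (induction k)
  case 0
  have "singular_chain 0 (top_of_set (- {0})) (octahedral_chain b 0)"
    using b by (intro singular_chain_octahedral_chain) simp
  then have "c 0 = frag_of (affine_simplex 0 (signed_vertices {} b))"
    unfolding c_def by (simp add: singular_subdivision_power_zero) (simp add: octahedral_chain_def)
  then show ?case
    by (simp add: alternating_count_def vertex_labels_def sort_alternating_def)
next
  case (Suc k)
  have sing: "singular_chain j (top_of_set (- {0})) (octahedral_chain b j)" if "j \<le> Suc k" for j
    using that Suc.prems by (intro singular_chain_octahedral_chain b) auto
  have "chain_boundary (Suc k) (c (Suc k)) = frag_cmul ((- 1) ^ Suc k)
      (c k + frag_cmul ((- 1) ^ Suc k) (chain_map k uminus (c k)))"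
    unfolding c_def chain_boundary_singular_subdivision_power[OF sing[OF order_refl]]
      chain_boundary_octahedral_chain diff_Suc_1 singular_subdivision_power_cmul
      singular_subdivision_power_add
    using chain_map_singular_subdivision_power[OF sing[of k], of m uminus] by simp
  moreover have "alternating_count True L k (chain_map k uminus (c k)) =
      alternating_count False L k (c k)"
    using Suc.prems alternating_count_uminus[of k "c k" L True] L free sing[of k]
    by (simp add: c_def singular_chain_singular_subdivision_power)
  ultimately have "alternating_count True L k (chain_boundary (Suc k) (c (Suc k))) =
      (- 1) ^ Suc k * (alternating_count True L k (c k) +
        (- 1) ^ Suc k * alternating_count False L k (c k))"
    by (simp add: alternating_count_def chain_count_cmul chain_count_add)
  then show ?case
    using alternating_count_boundary[of "Suc k" True L "c (Suc k)"] Suc by auto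
qed

text \<open>Working on the punctured space instead of the sphere lets the affine octahedral
  simplices be used without radial projection.\<close>

theorem Borsuk_Ulam_common_zero:
  fixes g :: "nat \<Rightarrow> 'a::euclidean_space \<Rightarrow> real"
  assumes cont: "\<And>i. i < N \<Longrightarrow> continuous_on (- {0}) (g i)"
    and odd: "\<And>i x. i < N \<Longrightarrow> x \<noteq> 0 \<Longrightarrow> g i (- x) = - g i x"
    and "N < DIM('a)"
  shows "\<exists>x. x \<noteq> 0 \<and> (\<forall>i<N. g i x = 0)"
proof (rule ccontr)
  assume no_zero: "\<not> (\<exists>x. x \<noteq> 0 \<and> (\<forall>i<N. g i x = 0))"
  define P where "P x i \<longleftrightarrow> i < N \<and> (\<forall>j<N. \<bar>g j x\<bar> \<le> \<bar>g i x\<bar>)" for x i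
  \<comment> \<open>The choice is made from a predicate in the moduli alone, so antipodal points get
    the same index.\<close>
  define idx where "idx x = (SOME i. P x i)" for x
  have P_idx: "P x (idx x)" and g_idx: "g (idx x) x \<noteq> 0" if x: "x \<noteq> 0" for x
  proof -
    from no_zero x obtain i where i: "i < N" "g i x \<noteq> 0" by blast
    define M where "M = Max ((\<lambda>j. \<bar>g j x\<bar>) ` {..<N})"
    have "M \<in> (\<lambda>j. \<bar>g j x\<bar>) ` {..<N}"
      unfolding M_def using i by (intro Max_in) auto
    then obtain j where "j < N" "M = \<bar>g j x\<bar>" by auto
    then have "P x j"
      unfolding P_def M_def[symmetric] by (metis M_def Max_ge finite_imageI finite_lessThan imageI lessThan_iff)
    then show "P x (idx x)"
      unfolding idx_def by (rule someI)
    with i show "g (idx x) x \<noteq> 0"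
      by (auto simp: P_def)
  qed
  have idx_minus: "idx (- x) = idx x" if "x \<noteq> 0" for x
  proof -
    have "P (- x) = P x"
      using odd[OF _ that] by (auto simp: P_def fun_eq_iff)
    then show ?thesis by (simp add: idx_def)
  qed
  define L where "L x = 2 * idx x + of_bool (g (idx x) x < 0)" for x
  have L_minus: "L (- x) = opposite (L x)" if "x \<noteq> 0" for x
    using g_idx[OF that] P_idx[OF that] odd[OF _ that]
    by (auto simp: L_def idx_minus[OF that] opposite_def P_def)
  \<comment> \<open>The radius is half the largest modulus at \<open>y\<close>: small enough to
    exclude opposite labels within one \<open>V y\<close>.\<close>
  define V where "V y = {x \<in> - {0}. \<forall>i<N. \<bar>g i x - g i y\<bar> < \<bar>g (idx y) y\<bar> / 2}" for y
  have V_open: "openin (top_of_set (- {0})) (V y)" for y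
  proof -
    have *: "V y = (\<Inter>i\<in>{..<N}. {x \<in> - {0}. \<bar>g i x - g i y\<bar> < \<bar>g (idx y) y\<bar> / 2}) \<inter> - {0}"
      by (auto simp: V_def)
    have "openin (top_of_set (- {0})) {x \<in> - {0}. \<bar>g i x - g i y\<bar> < \<bar>g (idx y) y\<bar> / 2}" if "i < N" for i
    proof -
      have "continuous_on (- {0}) (\<lambda>x. \<bar>g i x - g i y\<bar>)"
        using cont[OF that] by (intro continuous_intros)
      from continuous_openin_preimage_gen[OF this open_lessThan[of "\<bar>g (idx y) y\<bar> / 2"]]
      show ?thesis by (simp add: vimage_def Int_def)
    qed
    then show ?thesis
      unfolding * by (cases "N = 0") (auto intro!: openin_Int openin_INT2)
  qed
  have complementary: False if "u \<in> V y" "v \<in> V y" "y \<noteq> 0" "L v = opposite (L u)" for u v y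
  proof -
    have uv: "u \<noteq> 0" "v \<noteq> 0" using that by (auto simp: V_def)
    from that(4) have idx: "idx v = idx u"
      by (auto simp: L_def opposite_def of_bool_def split: if_splits; presburger)
    with that(4) have sgn: "g (idx u) u < 0 \<longleftrightarrow> \<not> g (idx u) v < 0"
      by (auto simp: L_def opposite_def of_bool_def split: if_splits)
    have small: "\<bar>g i w - g i y\<bar> < \<bar>g (idx y) y\<bar> / 2" if "w \<in> {u, v}" "i < N" for i w
      using that \<open>u \<in> V y\<close> \<open>v \<in> V y\<close> by (auto simp: V_def)
    \<comment> \<open>The component chosen at \<open>w\<close> has modulus above half the maximum at
      \<open>y\<close>. Opposite signs at \<open>u\<close> and \<open>v\<close> would put the two
      values further apart than that maximum, yet both lie within half of it from the value at
      \<open>y\<close>.\<close>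
    have large: "\<bar>g (idx y) y\<bar> / 2 < \<bar>g (idx w) w\<bar>" if w: "w \<in> {u, v}" for w
    proof -
      have "idx y < N" using P_idx[OF \<open>y \<noteq> 0\<close>] by (simp add: P_def)
      moreover have "\<bar>g (idx y) w\<bar> \<le> \<bar>g (idx w) w\<bar>"
        using P_idx[of w] uv w calculation by (auto simp: P_def)
      ultimately show ?thesis using small[OF w, of "idx y"] by linarith
    qed
    have "idx u < N" using P_idx[OF uv(1)] by (simp add: P_def)
    with small[of u "idx u"] small[of v "idx u"] large[of u] large[of v] idx sgn show False
      by (auto simp: abs_if split: if_splits)
  qed
  obtain b :: "nat \<Rightarrow> 'a" where b: "bij_betw b {0..<DIM('a)} Basis"
    using ex_bij_betw_nat_finite[OF finite_Basis] by blast
  have ortho: "b i \<bullet> b j = of_bool (i = j)" if "i \<le> N" "j \<le> N" for i j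
  proof -
    have "b i \<in> Basis" "b j \<in> Basis" "b i = b j \<longleftrightarrow> i = j"
      using b that \<open>N < DIM('a)\<close> by (auto simp: bij_betw_def inj_on_def)
    then show ?thesis by (simp add: inner_Basis)
  qed
  have "\<exists>n. \<forall>m f. n \<le> m \<longrightarrow> f \<in> Poly_Mapping.keys ((singular_subdivision k ^^ m) (octahedral_chain b k)) \<longrightarrow>
      (\<exists>W\<in>V ` (- {0}). f \<in> standard_simplex k \<rightarrow> W)" if "k \<le> N" for k
  proof (rule sufficient_iterated_singular_subdivision_exists)
    show "singular_chain k (top_of_set (- {0})) (octahedral_chain b k)"
      using that by (intro singular_chain_octahedral_chain ortho) auto
    show "topspace (top_of_set (- {0})) \<subseteq> \<Union> (V ` (- {0}))"
      using g_idx by (fastforce simp: V_def)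
  qed (use V_open in auto)
  then obtain n where n: "\<And>k m f. k \<le> N \<Longrightarrow> n k \<le> m \<Longrightarrow>
      f \<in> Poly_Mapping.keys ((singular_subdivision k ^^ m) (octahedral_chain b k)) \<Longrightarrow>
      \<exists>W\<in>V ` (- {0}). f \<in> standard_simplex k \<rightarrow> W"
    by metis
  \<comment> \<open>The induction over \<open>k\<close> compares chains of adjacent dimensions, so
    one number of subdivisions must serve all \<open>k \<le> N\<close>.\<close>
  define m where "m = Max (n ` {..N})"
  have nm: "n k \<le> m" if "k \<le> N" for k
    unfolding m_def using that by (intro Max_ge) auto
  let ?c = "\<lambda>k. (singular_subdivision k ^^ m) (octahedral_chain b k)"
  have vertices: "\<exists>y. y \<noteq> 0 \<and> set (vertex_labels L k f) \<subseteq> L ` V y"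
    if k: "k \<le> N" and f: "f \<in> Poly_Mapping.keys (?c k)" for k f
  proof -
    from n[OF k nm[OF k] f] obtain y where "y \<noteq> 0" "f \<in> standard_simplex k \<rightarrow> V y" by auto
    then show ?thesis
      by (intro exI[of _ y]) (auto simp: vertex_labels_def less_Suc_eq_le Pi_iff simp del: upt_Suc)
  qed
  have free: "complementary_free (set (vertex_labels L k f))"
    if k: "k \<le> N" and f: "f \<in> Poly_Mapping.keys (?c k)" for k f
    unfolding complementary_free_def
  proof (intro ballI notI)
    fix x assume x: "x \<in> set (vertex_labels L k f)" "opposite x \<in> set (vertex_labels L k f)"
    obtain y where y: "y \<noteq> 0" "set (vertex_labels L k f) \<subseteq> L ` V y"
      using vertices[OF k f] by blast
    from x(1) y(2) obtain u where u: "u \<in> V y" "x = L u" by blast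
    from x(2) y(2) obtain v where v: "v \<in> V y" "opposite x = L v" by blast
    show False
      using complementary[OF u(1) v(1) y(1)] u(2) v(2) by simp
  qed
  \<comment> \<open>An \<open>N\<close>-simplex has \<open>N + 1\<close> labels, one more than there
    are indices.\<close>
  have "\<not> sort_alternating s (vertex_labels L N f)" if f: "f \<in> Poly_Mapping.keys (?c N)" for s f
  proof
    assume "sort_alternating s (vertex_labels L N f)"
    moreover have "l < 2 * N" if "l \<in> set (vertex_labels L N f)" for l
    proof -
      obtain y where "set (vertex_labels L N f) \<subseteq> L ` V y"
        using vertices[OF order_refl f] by blast
      with that obtain x where "x \<in> V y" "l = L x" by blast
      then have "x \<noteq> 0" "l = L x" by (auto simp: V_def)
      with P_idx[of x] show ?thesis by (auto simp: L_def P_def)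
    qed
    ultimately have "length (vertex_labels L N f) \<le> N"
      using free[OF order_refl f] by (intro sort_alternating_length_le)
    then show False by simp
  qed
  then have "alternating_count s L N (?c N) = 0" for s
    by (simp add: alternating_count_def chain_count_eq_0)
  moreover have "odd (alternating_count True L N (?c N) + alternating_count False L N (?c N))"
    by (rule octahedral_alternating_count_odd[OF ortho L_minus free order_refl])
  ultimately show False by simp
qed

section \<open>Orthogonal frames from complex, quaternion and octonion multiplication\<close>

text \<open>With the Cayley-Dickson basis \<open>e 0, \<dots>, e 7\<close> of the octonions, coordinate \<open>a\<close> of the product
  \<open>e i * y\<close> is \<open>octonion_sign i a * y (xor i a)\<close>. The first two and the first four basis elements
  span the complex numbers and the quaternions.\<close>

definition octonion_sign :: "nat \<Rightarrow> nat \<Rightarrow> int" where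
  "octonion_sign i a =
     [[1, 1, 1, 1, 1, 1, 1, 1],
      [- 1, 1, - 1, 1, - 1, 1, 1, - 1],
      [- 1, 1, 1, - 1, - 1, - 1, 1, 1],
      [- 1, - 1, 1, 1, - 1, 1, - 1, 1],
      [- 1, 1, 1, 1, 1, - 1, - 1, - 1],
      [- 1, - 1, 1, - 1, 1, 1, 1, - 1],
      [- 1, - 1, - 1, 1, 1, - 1, 1, 1],
      [- 1, 1, - 1, - 1, 1, 1, - 1, 1]] ! i ! a"

lemma octonion_sign_square:
  assumes "i < 8" "a < 8"
  shows "octonion_sign i a * octonion_sign i a = 1"
proof -
  have "\<forall>i\<in>{..<8}. \<forall>a\<in>{..<8}. octonion_sign i a * octonion_sign i a = 1"
    by code_simp
  with assms show ?thesis unfolding Ball_def lessThan_iff by blast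
qed

text \<open>For the inner product of \<open>e i * y\<close> and \<open>e j * y\<close>: the
  involution \<open>xor a (xor i j)\<close> of the coordinates pairs terms of opposite sign. The
  claim is symmetric in \<open>i\<close> and \<open>j\<close>, so the table is checked for
  \<open>j < i\<close> only.\<close>

lemma octonion_sign_pairing:
  assumes "i < 8" "j < 8" "a < 8" "i \<noteq> j"
  shows "octonion_sign i (xor a (xor i j)) * octonion_sign j (xor a (xor i j)) =
    - (octonion_sign i a * octonion_sign j a)"
proof -
  have "\<forall>i\<in>{..<8}. \<forall>j\<in>{..<i}. \<forall>a\<in>{..<8}.
      octonion_sign i (xor a (xor i j)) * octonion_sign j (xor a (xor i j)) =
      - (octonion_sign i a * octonion_sign j a)"
    by code_simp
  then have less: "octonion_sign i (xor a (xor i j)) * octonion_sign j (xor a (xor i j)) =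
      - (octonion_sign i a * octonion_sign j a)" if "j < i" "i < 8" for i j
    using that \<open>a < 8\<close> unfolding Ball_def lessThan_iff by blast
  from \<open>i \<noteq> j\<close> consider "i < j" | "j < i" by linarith
  then show ?thesis
  proof cases
    case 1
    with less[of i j] \<open>j < 8\<close> show ?thesis by (simp add: mult.commute xor.commute[of i j])
  next
    case 2
    with less[of j i] \<open>i < 8\<close> show ?thesis by simp
  qed
qed

text \<open>Initial segments whose length is a power of 2 are closed under \<open>xor\<close>; this
  is why the first 2 or 4 basis elements can be used by themselves.\<close>

lemma xor_less:
  assumes "n \<in> {2, 4, 8}" "i < n" "a < n"
  shows "xor i a < (n :: nat)"
proof -
  have "\<forall>n\<in>{2, 4, 8}. \<forall>i\<in>{..<n}. \<forall>a\<in>{..<n}. xor i a < (n :: nat)"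
    by code_simp
  with assms show ?thesis unfolding Ball_def lessThan_iff by blast
qed

text \<open>Left multiplication by \<open>e i\<close>, with the coordinates numbered by
  \<open>\<phi>\<close>.\<close>

definition octonion_frame :: "('n \<Rightarrow> nat) \<Rightarrow> nat \<Rightarrow> real ^ 'n \<Rightarrow> real ^ 'n" where
  "octonion_frame \<phi> i x =
     (\<chi> a. of_int (octonion_sign i (\<phi> a)) * x $ inv_into UNIV \<phi> (xor i (\<phi> a)))"

lemma octonion_frame_minus: "octonion_frame \<phi> i (- x) = - octonion_frame \<phi> i x"
  by (simp add: octonion_frame_def vec_eq_iff)

lemma continuous_on_octonion_frame: "continuous_on S (octonion_frame \<phi> i)"
  unfolding octonion_frame_def by (intro continuous_intros)

text \<open>For \<open>i = j\<close> the signs square to 1 and \<open>xor i\<close> permutes the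
  coordinates. For \<open>i \<noteq> j\<close> the involution of
  \<open>octonion_sign_pairing\<close> exchanges the two coordinate factors and negates the sign, so
  the sum equals its own negative.\<close>

lemma inner_octonion_frame:
  fixes x :: "real ^ 'n"
  assumes n: "n \<in> {2, 4, 8}" and \<phi>: "bij_betw \<phi> (UNIV :: 'n set) {..<n}"
    and ij: "i < n" "j < n"
  shows "octonion_frame \<phi> i x \<bullet> octonion_frame \<phi> j x = (if i = j then x \<bullet> x else 0)"
proof -
  define y where "y k = x $ inv_into UNIV \<phi> k" for k
  define F where "F a = of_int (octonion_sign i a * octonion_sign j a) * (y (xor i a) * y (xor j a))" for a
  have n_le: "n \<le> 8" using n by auto
  have reindex: "(\<Sum>a\<in>UNIV. h (\<phi> a)) = sum h {..<n}" for h :: "nat \<Rightarrow> real"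
    using \<phi> by (rule sum.reindex_bij_betw)
  have "octonion_frame \<phi> i x \<bullet> octonion_frame \<phi> j x = sum F {..<n}"
    unfolding reindex[symmetric]
    by (simp add: inner_vec_def octonion_frame_def F_def y_def mult_ac)
  also have "\<dots> = (if i = j then x \<bullet> x else 0)"
  proof (cases "i = j")
    case True
    have "sum F {..<n} = (\<Sum>a<n. y (xor i a) * y (xor i a))"
      using ij n_le True by (intro sum.cong) (auto simp: F_def octonion_sign_square)
    also have "\<dots> = (\<Sum>a<n. y a * y a)"
      using xor_less[OF n ij(1)]
      by (intro sum.reindex_bij_witness[of _ "xor i" "xor i"]) (auto simp flip: xor.assoc)
    also have "\<dots> = (\<Sum>a\<in>UNIV. y (\<phi> a) * y (\<phi> a))"
      by (rule reindex[symmetric])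
    also have "\<dots> = x \<bullet> x"
      using \<phi> by (simp add: inner_vec_def y_def bij_betw_def inv_into_f_f)
    finally show ?thesis using True by simp
  next
    case False
    have less: "xor a (xor i j) < n" if "a < n" for a
      using xor_less[OF n that xor_less[OF n ij]] .
    have "sum F {..<n} = (\<Sum>a<n. - F a)"
    proof (rule sum.reindex_bij_witness[of _ "\<lambda>a. xor a (xor i j)" "\<lambda>a. xor a (xor i j)"])
      fix a assume a: "a \<in> {..<n}"
      have "xor i (xor a (xor i j)) = xor j a"
        by (metis xor.assoc xor.commute xor_self_eq xor.right_neutral)
      moreover have "xor j (xor a (xor i j)) = xor i a"
        by (metis xor.assoc xor.commute xor_self_eq xor.right_neutral)
      ultimately show "- F (xor a (xor i j)) = F a"
        using octonion_sign_pairing[of i j a] a ij n_le False by (simp add: F_def mult.commute)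
    qed (auto simp: xor.assoc less)
    with False show ?thesis by (simp add: sum_negf)
  qed
  finally show ?thesis .
qed

section \<open>Medians of mass distributions\<close>

lemma mass_distribution_space: "mass_distribution \<mu> \<Longrightarrow> space \<mu> = UNIV"
  unfolding mass_distribution_def by (metis sets_eq_imp_space_eq space_borel)

text \<open>Absolute continuity enters only here.\<close>

lemma mass_distribution_hyperplane_null:
  fixes v :: "'a::euclidean_space"
  assumes "mass_distribution \<mu>" "v \<noteq> 0"
  shows "{x. v \<bullet> x = t} \<in> null_sets \<mu>"
proof -
  have "{x. v \<bullet> x = t} \<in> null_sets lebesgue"
    using assms(2) negligible_hyperplane[of v t] by (simp add: negligible_iff_null_sets)
  moreover have "{x. v \<bullet> x = t} \<in> sets lborel"
    by (simp add: closed_hyperplane)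
  ultimately have "{x. v \<bullet> x = t} \<in> null_sets lborel"
    by (auto simp: null_sets_def)
  with assms(1) show ?thesis
    by (auto simp: mass_distribution_def absolutely_continuous_def)
qed

definition halfspace_mass :: "'a::euclidean_space measure \<Rightarrow> 'a \<Rightarrow> real \<Rightarrow> real" where
  "halfspace_mass \<mu> v t = measure \<mu> {x. v \<bullet> x \<le> t}"

context
  fixes \<mu> :: "'a::euclidean_space measure"
  assumes \<mu>: "mass_distribution \<mu>"
begin

interpretation finite_measure \<mu>
  using \<mu> by (simp add: mass_distribution_def)

lemma sets_mass_distribution [measurable_cong]: "sets \<mu> = sets borel"
  using \<mu> by (simp add: mass_distribution_def)

lemma halfspace_mass_mono: "s \<le> t \<Longrightarrow> halfspace_mass \<mu> v s \<le> halfspace_mass \<mu> v t"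
  unfolding halfspace_mass_def
  by (intro finite_measure_mono) (auto simp: sets_mass_distribution)

lemma halfspace_mass_upper:
  assumes "v \<noteq> 0"
  shows "measure \<mu> {x. v \<bullet> x \<ge> t} = measure \<mu> UNIV - halfspace_mass \<mu> v t"
proof -
  have "measure \<mu> UNIV = measure \<mu> ({x. v \<bullet> x \<le> t} \<union> {x. v \<bullet> x \<ge> t})"
    by (rule arg_cong[where f = "measure \<mu>"]) auto
  also have "\<dots> = measure \<mu> {x. v \<bullet> x \<le> t} + measure \<mu> {x. v \<bullet> x \<ge> t} -
      measure \<mu> ({x. v \<bullet> x \<le> t} \<inter> {x. v \<bullet> x \<ge> t})"
    by (rule measure_Un3) (auto simp: fmeasurable_eq_sets sets_mass_distribution)
  also have "{x. v \<bullet> x \<le> t} \<inter> {x. v \<bullet> x \<ge> t} = {x. v \<bullet> x = t}"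
    by auto
  also have "measure \<mu> {x. v \<bullet> x = t} = 0"
    using mass_distribution_hyperplane_null[OF \<mu> assms] by (rule measure_eq_0_null_sets)
  finally show ?thesis by (simp add: halfspace_mass_def)
qed

lemma halfspace_mass_minus:
  "v \<noteq> 0 \<Longrightarrow> halfspace_mass \<mu> (- v) t = measure \<mu> UNIV - halfspace_mass \<mu> v (- t)"
  using halfspace_mass_upper[of v "- t"] by (simp add: halfspace_mass_def minus_le_iff)

text \<open>Joint continuity in direction and threshold: the indicators converge off the limiting
  hyperplane, which is null, and the constant 1 dominates them.\<close>

lemma halfspace_mass_dominated_convergence:
  assumes v: "u \<longlonglongrightarrow> v" and t: "s \<longlonglongrightarrow> t" and "v \<noteq> 0"
  shows "(\<lambda>k. halfspace_mass \<mu> (u k) (s k)) \<longlonglongrightarrow> halfspace_mass \<mu> v t"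
proof -
  have eq: "halfspace_mass \<mu> w r = (\<integral>x. indicator {x. w \<bullet> x \<le> r} x \<partial>\<mu>)" for w r
    by (simp add: halfspace_mass_def mass_distribution_space[OF \<mu>])
  have "AE x in \<mu>. v \<bullet> x \<noteq> t"
    by (rule AE_I'[OF mass_distribution_hyperplane_null[OF \<mu> \<open>v \<noteq> 0\<close>, of t]]) auto
  then have "AE x in \<mu>. (\<lambda>k. indicator {x. u k \<bullet> x \<le> s k} x :: real) \<longlonglongrightarrow> indicator {x. v \<bullet> x \<le> t} x"
  proof (eventually_elim)
    case (elim x)
    have lim: "(\<lambda>k. s k - u k \<bullet> x) \<longlonglongrightarrow> t - v \<bullet> x"
      by (intro tendsto_intros v t)
    from elim consider "0 < t - v \<bullet> x" | "t - v \<bullet> x < 0" by linarith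
    then have "\<forall>\<^sub>F k in sequentially. u k \<bullet> x \<le> s k \<longleftrightarrow> v \<bullet> x \<le> t"
    proof cases
      case 1
      show ?thesis using order_tendstoD(1)[OF lim 1] by eventually_elim (use 1 in auto)
    next
      case 2
      show ?thesis using order_tendstoD(2)[OF lim 2] by eventually_elim (use 2 in auto)
    qed
    then show ?case
      by (intro tendsto_eventually) (auto elim!: eventually_mono simp: indicator_def)
  qed
  then show ?thesis
    unfolding eq
    by (intro integral_dominated_convergence[where w = "\<lambda>_. 1"])
      (auto simp: indicator_def)
qed

lemma halfspace_mass_at_top:
  "(\<lambda>k. halfspace_mass \<mu> v (real k)) \<longlonglongrightarrow> measure \<mu> UNIV"
proof -
  have "(\<lambda>k. measure \<mu> {x. v \<bullet> x \<le> real k}) \<longlonglongrightarrow> measure \<mu> (\<Union>k. {x. v \<bullet> x \<le> real k})"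
    by (rule finite_Lim_measure_incseq) (auto simp: sets_mass_distribution incseq_def)
  moreover have "(\<Union>k. {x. v \<bullet> x \<le> real k}) = UNIV"
    using real_arch_simple by auto
  ultimately show ?thesis by (simp add: halfspace_mass_def)
qed

lemma halfspace_mass_at_bot:
  "v \<noteq> 0 \<Longrightarrow> (\<lambda>k. halfspace_mass \<mu> v (- real k)) \<longlonglongrightarrow> 0"
  using tendsto_diff[OF tendsto_const[of "measure \<mu> UNIV"] halfspace_mass_at_top[of "- v"]]
  by (simp add: halfspace_mass_minus)

end

section \<open>Joint medians of two mass distributions\<close>

context
  fixes \<mu> \<nu> :: "'a::euclidean_space measure"
  assumes \<mu>: "mass_distribution \<mu>" and \<nu>: "mass_distribution \<nu>"
begin

definition joint_median :: "'a \<Rightarrow> real \<Rightarrow> bool" where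
  "joint_median v t \<longleftrightarrow>
     halfspace_mass \<mu> v t + halfspace_mass \<nu> v t = (measure \<mu> UNIV + measure \<nu> UNIV) / 2"

lemma joint_median_exists:
  assumes "v \<noteq> 0"
  shows "\<exists>t. joint_median v t"
proof -
  define h where "h t = halfspace_mass \<mu> v t + halfspace_mass \<nu> v t" for t
  define m where "m = measure \<mu> UNIV + measure \<nu> UNIV"
  have top: "(\<lambda>k. h (real k)) \<longlonglongrightarrow> m" and bot: "(\<lambda>k. h (- real k)) \<longlonglongrightarrow> 0"
    using tendsto_add[OF halfspace_mass_at_top[OF \<mu>, of v] halfspace_mass_at_top[OF \<nu>, of v]]
      tendsto_add[OF halfspace_mass_at_bot[OF \<mu> assms] halfspace_mass_at_bot[OF \<nu> assms]]
    by (simp_all add: h_def m_def)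
  have mono: "h s \<le> h t" if "s \<le> t" for s t
    using that unfolding h_def by (intro add_mono halfspace_mass_mono \<mu> \<nu>)
  have cont: "continuous_on UNIV h"
    unfolding continuous_on_sequentially h_def comp_def
    by (auto intro!: tendsto_add halfspace_mass_dominated_convergence \<mu> \<nu> assms)
  have "\<exists>t. h t = m / 2"
  proof (cases "m = 0")
    \<comment> \<open>Here \<open>m / 2\<close> coincides with both limits, so the intermediate
      value argument has no strict inequalities to start from; the threshold 0 serves.\<close>
    case True
    have "h 0 \<le> m"
      by (rule LIMSEQ_le_const[OF top]) (auto intro!: exI[of _ 0] mono)
    moreover have "0 \<le> h 0"
      by (simp add: h_def halfspace_mass_def)
    ultimately show ?thesis using True by auto
  next
    case False
    moreover have "0 \<le> m" by (simp add: m_def)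
    ultimately have "m / 2 < m" "0 < m / 2" by linarith+
    from order_tendstoD(1)[OF top this(1)] order_tendstoD(2)[OF bot this(2)]
    have "\<forall>\<^sub>F k in sequentially. h (- real k) \<le> m / 2 \<and> m / 2 \<le> h (real k)"
      by eventually_elim auto
    then obtain k :: nat where "h (- real k) \<le> m / 2" "m / 2 \<le> h (real k)"
      by (auto simp: eventually_sequentially)
    then show ?thesis
      using IVT'[of h "- real k" "m / 2" "real k"] continuous_on_subset[OF cont] by auto
  qed
  then show ?thesis
    by (simp add: joint_median_def h_def m_def)
qed

text \<open>The difference of the joint masses dominates because both masses grow with the threshold.\<close>

lemma halfspace_mass_diff_le:
  "\<bar>halfspace_mass \<mu> v s - halfspace_mass \<mu> v t\<bar> \<le>
   \<bar>(halfspace_mass \<mu> v s + halfspace_mass \<nu> v s) - (halfspace_mass \<mu> v t + halfspace_mass \<nu> v t)\<bar>"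
  using halfspace_mass_mono[OF \<mu>, of s t v] halfspace_mass_mono[OF \<mu>, of t s v]
    halfspace_mass_mono[OF \<nu>, of s t v] halfspace_mass_mono[OF \<nu>, of t s v]
  by linarith

definition median_excess :: "'a \<Rightarrow> real" where
  "median_excess v = halfspace_mass \<mu> v (SOME t. joint_median v t) - measure \<mu> UNIV / 2"

text \<open>Between two joint medians the joint mass does not change, so by
  \<open>halfspace_mass_diff_le\<close> neither does the first mass.\<close>

lemma median_excess_eq:
  assumes "joint_median v t"
  shows "median_excess v = halfspace_mass \<mu> v t - measure \<mu> UNIV / 2"
proof -
  define s where "s = (SOME t. joint_median v t)"
  have "joint_median v s"
    unfolding s_def using assms by (rule someI)
  with assms have "halfspace_mass \<mu> v s = halfspace_mass \<mu> v t"
    using halfspace_mass_diff_le[of v s t] by (simp add: joint_median_def)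
  then show ?thesis
    by (simp add: median_excess_def s_def)
qed

lemma median_excess_minus:
  assumes "v \<noteq> 0"
  shows "median_excess (- v) = - median_excess v"
proof -
  obtain t where t: "joint_median v t"
    using joint_median_exists[OF assms] by blast
  then have "joint_median (- v) (- t)"
    using assms by (simp add: joint_median_def halfspace_mass_minus[OF \<mu>] halfspace_mass_minus[OF \<nu>] field_simps)
  from median_excess_eq[OF this] median_excess_eq[OF t] show ?thesis
    using assms by (simp add: halfspace_mass_minus[OF \<mu>])
qed

text \<open>A median \<open>t\<close> of the limit direction is kept fixed. Along
  \<open>u k\<close>, replacing the true median by \<open>t\<close> changes the first mass by at
  most the deviation of the joint mass at \<open>t\<close> from one half, which tends to 0; the
  medians themselves may fail to converge.\<close>

lemma continuous_on_median_excess: "continuous_on (- {0}) median_excess"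
  unfolding continuous_on_sequentially
proof (intro ballI allI impI, elim conjE)
  fix v u assume v: "v \<in> - {0 :: 'a}" and u: "\<forall>k. u k \<in> - {0 :: 'a}" "u \<longlonglongrightarrow> v"
  obtain t where t: "joint_median v t"
    using joint_median_exists v by blast
  define m where "m = (measure \<mu> UNIV + measure \<nu> UNIV) / 2"
  have lim\<^sub>\<mu>: "(\<lambda>k. halfspace_mass \<mu> (u k) t) \<longlonglongrightarrow> halfspace_mass \<mu> v t"
    and lim\<^sub>\<nu>: "(\<lambda>k. halfspace_mass \<nu> (u k) t) \<longlonglongrightarrow> halfspace_mass \<nu> v t"
    using v u(2) by (auto intro!: halfspace_mass_dominated_convergence \<mu> \<nu>)
  have "(\<lambda>k. m - (halfspace_mass \<mu> (u k) t + halfspace_mass \<nu> (u k) t)) \<longlonglongrightarrow>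
      m - (halfspace_mass \<mu> v t + halfspace_mass \<nu> v t)"
    by (intro tendsto_intros lim\<^sub>\<mu> lim\<^sub>\<nu>)
  then have lim_0: "(\<lambda>k. m - (halfspace_mass \<mu> (u k) t + halfspace_mass \<nu> (u k) t)) \<longlonglongrightarrow> 0"
    using t by (simp only: joint_median_def m_def diff_self)
  have "norm (median_excess (u k) - (halfspace_mass \<mu> (u k) t - measure \<mu> UNIV / 2)) \<le>
      norm (m - (halfspace_mass \<mu> (u k) t + halfspace_mass \<nu> (u k) t))" for k
  proof -
    obtain s where s: "joint_median (u k) s"
      using joint_median_exists u(1) by blast
    show ?thesis
      using halfspace_mass_diff_le[of "u k" s t] s[unfolded joint_median_def, folded m_def]
      by (simp add: median_excess_eq[OF s])
  qed
  then have "(\<lambda>k. median_excess (u k) - (halfspace_mass \<mu> (u k) t - measure \<mu> UNIV / 2)) \<longlonglongrightarrow> 0"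
    by (intro Lim_null_comparison[OF always_eventually tendsto_norm_zero[OF lim_0]]) auto
  from tendsto_add[OF this tendsto_diff[OF lim\<^sub>\<mu> tendsto_const[of "measure \<mu> UNIV / 2"]]]
  show "(median_excess \<circ> u) \<longlonglongrightarrow> median_excess v"
    by (simp add: median_excess_eq[OF t] comp_def)
qed

lemma median_excess_eq_0_imp_bisects:
  assumes "v \<noteq> 0" "median_excess v = 0"
  shows "\<exists>t. bisects {x. v \<bullet> x = t} \<mu> \<and> bisects {x. v \<bullet> x = t} \<nu>"
proof -
  obtain t where t: "joint_median v t"
    using joint_median_exists[OF assms(1)] by blast
  have "halfspace_mass \<mu> v t = measure \<mu> UNIV / 2"
    using median_excess_eq[OF t] assms(2) by simp
  moreover from this have "halfspace_mass \<nu> v t = measure \<nu> UNIV / 2"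
    using t by (simp add: joint_median_def field_simps)
  ultimately have "bisects {x. v \<bullet> x = t} \<mu>" "bisects {x. v \<bullet> x = t} \<nu>"
    using assms(1) halfspace_mass_upper[OF \<mu> assms(1), of t] halfspace_mass_upper[OF \<nu> assms(1), of t]
    unfolding bisects_def by (auto simp: halfspace_mass_def intro!: exI[of _ v] exI[of _ t])
  then show ?thesis by blast
qed

end

section \<open>Normal lines and orthogonality of hyperplanes\<close>

lemma normal_line_hyperplane:
  fixes a :: "'a::euclidean_space"
  assumes "a \<noteq> 0"
  shows "normal_line {x. a \<bullet> x = b} = span {a}"
proof (intro equalityI subsetI)
  fix u assume u: "u \<in> normal_line {x. a \<bullet> x = b}"
  \<comment> \<open>\<open>w\<close> is the part of \<open>u\<close> orthogonal to \<open>a\<close>,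
    and \<open>p\<close> is the point of the hyperplane nearest to 0. Since \<open>p\<close> and
    \<open>p + w\<close> both lie in it, \<open>u\<close> is orthogonal to \<open>w\<close>, which
    forces \<open>w = 0\<close>.\<close>
  define w where "w = u - (u \<bullet> a / (a \<bullet> a)) *\<^sub>R a"
  define p where "p = (b / (a \<bullet> a)) *\<^sub>R a"
  have aw: "a \<bullet> w = 0"
    using assms by (simp add: w_def inner_diff_right inner_commute)
  moreover have "a \<bullet> p = b"
    using assms by (simp add: p_def)
  ultimately have "p + w \<in> {x. a \<bullet> x = b}" "p \<in> {x. a \<bullet> x = b}"
    by (simp_all add: inner_add_right)
  with u have "u \<bullet> w = 0"
    unfolding normal_line_def orthogonal_def by fastforce
  then have "w \<bullet> w = 0"
    using aw by (simp add: w_def inner_diff_left)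
  then have "u = (u \<bullet> a / (a \<bullet> a)) *\<^sub>R a"
    by (simp add: w_def)
  then show "u \<in> span {a}"
    by (metis span_mul span_base singletonI)
next
  fix u assume "u \<in> span {a}"
  then obtain c where "u = c *\<^sub>R a"
    by (auto simp: span_singleton)
  then show "u \<in> normal_line {x. a \<bullet> x = b}"
    by (auto simp: normal_line_def orthogonal_def inner_diff_right)
qed

lemma orthogonal_hyperplanes_iff:
  fixes a a' :: "'a::euclidean_space"
  assumes "a \<noteq> 0" "a' \<noteq> 0"
  shows "orthogonal_hyperplanes {x. a \<bullet> x = b} {x. a' \<bullet> x = b'} \<longleftrightarrow> a \<bullet> a' = 0"
proof -
  have "(\<forall>u\<in>span {a}. \<forall>v\<in>span {a'}. orthogonal u v) \<longleftrightarrow> orthogonal a a'"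
    by (auto simp: span_singleton orthogonal_def intro: span_base)
  then show ?thesis
    by (simp add: orthogonal_hyperplanes_def normal_line_hyperplane assms orthogonal_def)
qed

section \<open>Orthogonal bisecting hyperplanes\<close>

theorem mainTheorem4:
  fixes \<mu>\<^sub>1 \<mu>\<^sub>2 :: "(real ^ 'n) measure"
  assumes "CARD('n) \<in> {2, 4, 8}"
    and "mass_distribution \<mu>\<^sub>1" and "mass_distribution \<mu>\<^sub>2"
  shows "\<exists>\<H> :: (real ^ 'n) set set.
           card \<H> = CARD('n) - 1 \<and>
           (\<forall>H\<in>\<H>. hyperplane H \<and> bisects H \<mu>\<^sub>1 \<and> bisects H \<mu>\<^sub>2) \<and>
           pairwise orthogonal_hyperplanes \<H>"
proof -
  let ?n = "CARD('n)"
  let ?f = "median_excess \<mu>\<^sub>1 \<mu>\<^sub>2"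
  obtain \<phi> :: "'n \<Rightarrow> nat" where \<phi>: "bij_betw \<phi> UNIV {..<?n}"
    using ex_bij_betw_finite_nat[of "UNIV :: 'n set"] by (auto simp: atLeast0LessThan)
  note inner_frame = inner_octonion_frame[OF assms(1) \<phi>]
  have frame_nz: "octonion_frame \<phi> i x \<noteq> 0" if "x \<noteq> 0" "i < ?n" for i x
    using inner_frame[OF that(2,2), of x] that(1) by auto
  \<comment> \<open>Dimension \<open>n\<close> allows \<open>n - 1\<close> odd functions, so the
    last of the \<open>n\<close> frame vectors is left out.\<close>
  have "\<exists>x. x \<noteq> 0 \<and> (\<forall>i<?n - 1. ?f (octonion_frame \<phi> i x) = 0)"
  proof (rule Borsuk_Ulam_common_zero)
    fix i assume i: "i < ?n - 1"
    then have "i < ?n" by simp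
    then have "octonion_frame \<phi> i ` (- {0}) \<subseteq> - {0}"
      unfolding image_subset_iff Compl_iff singleton_iff using frame_nz by blast
    then show "continuous_on (- {0}) (\<lambda>x. ?f (octonion_frame \<phi> i x))"
      by (rule continuous_on_compose2[OF continuous_on_median_excess[OF assms(2,3)]
            continuous_on_octonion_frame])
  next
    fix i and x :: "real ^ 'n" assume "i < ?n - 1" "x \<noteq> 0"
    then show "?f (octonion_frame \<phi> i (- x)) = - ?f (octonion_frame \<phi> i x)"
      using frame_nz by (simp add: octonion_frame_minus median_excess_minus assms(2,3))
  qed simp
  then obtain x where x: "x \<noteq> 0" "\<And>i. i < ?n - 1 \<Longrightarrow> ?f (octonion_frame \<phi> i x) = 0"
    by blast
  define v where "v i = octonion_frame \<phi> i x" for i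
  have v_nz: "v i \<noteq> 0" if "i < ?n - 1" for i
    using that frame_nz[OF x(1)] by (simp add: v_def)
  have "\<forall>i\<in>{..<?n - 1}. \<exists>t. bisects {y. v i \<bullet> y = t} \<mu>\<^sub>1 \<and> bisects {y. v i \<bullet> y = t} \<mu>\<^sub>2"
    using median_excess_eq_0_imp_bisects[OF assms(2,3)] v_nz x(2) by (simp add: v_def)
  then obtain t where t: "\<And>i. i < ?n - 1 \<Longrightarrow>
      bisects {y. v i \<bullet> y = t i} \<mu>\<^sub>1 \<and> bisects {y. v i \<bullet> y = t i} \<mu>\<^sub>2"
    by (metis lessThan_iff)
  define H where "H i = {y. v i \<bullet> y = t i}" for i
  \<comment> \<open>The case \<open>i = j\<close> also matters: no hyperplane is orthogonal to
    itself, so the \<open>H i\<close> are distinct and the family has the full cardinality.\<close>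
  have orth: "orthogonal_hyperplanes (H i) (H j) \<longleftrightarrow> i \<noteq> j" if "i < ?n - 1" "j < ?n - 1" for i j
    using that inner_frame[of i j x] x(1)
    by (simp add: H_def orthogonal_hyperplanes_iff v_nz) (simp add: v_def)
  have "inj_on H {..<?n - 1}"
  proof (rule inj_onI)
    fix i j assume "i \<in> {..<?n - 1}" "j \<in> {..<?n - 1}" "H i = H j"
    then show "i = j"
      using orth[of i i] orth[of i j] by auto
  qed
  then have "card (H ` {..<?n - 1}) = ?n - 1"
    by (simp add: card_image)
  moreover have "\<forall>h\<in>H ` {..<?n - 1}. hyperplane h \<and> bisects h \<mu>\<^sub>1 \<and> bisects h \<mu>\<^sub>2"
    using t v_nz by (auto simp: H_def hyperplane_def)
  moreover have "pairwise orthogonal_hyperplanes (H ` {..<?n - 1})"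
    using orth by (auto simp: pairwise_def)
  ultimately show ?thesis
    by blast
qed

end
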